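(* For any consistent triple set $R$, $$\mathfrak L^*(R;R)=\mathfrak L^*(\mathrm{cl}(R);R)=\mathfrak L^*(\mathrm{cl}(R);\mathrm{cl}(R)).$$
   Context: A rooted tree $T$ has a distinguished inner vertex (root); leaves are degree-1 vertices; inner vertices other than the root have degree at least 3. A triple $ab|c$ is the rooted binary tree on leaves $a,b,c$ where the path from $a$ to $b$ avoids the path from $c$ to the root; $ab|c=ba|c$. A rooted tree displays $ab|c$ if $a,b,c$ are leaves and the path from $a$ to $b$ does not intersect the path from $c$ to the root; $\mathcal R(T)$ is the set of displayed triples. A triple set is consistent if some rooted tree displays all its triples. $L_R$ is the set of leaves appearing in $R$. $\mathrm{cl}(R)=\bigcap\mathcal R(T)$ over all rooted trees $T$ with leaf set $L_R$ displaying $R$ (note $\mathrm{cl}(R)$ is consistent with $L_{\mathrm{cl}(R)}=L_R$). For a triple set $S$ and $\mathcal L\subseteq L_S$, the Ahograph $[S,\mathcal L]$ has vertex set $\mathcal L$, distinct $x,y\in\mathcal L$ adjacent iff some $xy|z\in S$ has $z\in\mathcal L$; connected components are identified with vertex sets. For $a,b,c\in L_S$, $\mathfrak L(ab|c;S)$ is the set of unordered pairs $\{A,B\}$, $A,B\subseteq L_S$, such that $[S,A\cup B]$ has exactly two connected components $A$ and $B$, one containing $a,b$ and the other $c$. For consistent $S$ and $ab|c\in\mathrm{cl}(S)$ this set has a unique element maximizing $|A\cup B|$, denoted $\mathfrak L^*(ab|c;S)$; for $S'\subseteq\mathrm{cl}(S)$, $\mathfrak L^*(S';S)=\{\mathfrak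 L^*(r;S):r\in S'\}$. *)

theory Defs
  imports Main
begin

section \<open>Finite simple graphs and trees\<close>

record 'v graph =
  verts :: "'v set"
  edges :: "'v set set"

definition simple_graph :: "('v, 'm) graph_scheme \<Rightarrow> bool" where
  "simple_graph G \<longleftrightarrow> finite (verts G) \<and>
     edges G \<subseteq> {{u, v} | u v. u \<in> verts G \<and> v \<in> verts G \<and> u \<noteq> v}"

definition degree :: "('v, 'm) graph_scheme \<Rightarrow> 'v \<Rightarrow> nat" where
  "degree G v = card {u \<in> verts G. {v, u} \<in> edges G}"

definition path :: "('v, 'm) graph_scheme \<Rightarrow> 'v \<Rightarrow> 'v list \<Rightarrow> 'v \<Rightarrow> bool" where
  "path G u p v \<longleftrightarrow> p \<noteq> [] \<and> hd p = u \<and> last p = v \<and> distinct p \<and> set p \<subseteq> verts G \<and>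
     successively (\<lambda>x y. {x, y} \<in> edges G) p"

definition cycle :: "('v, 'm) graph_scheme \<Rightarrow> 'v list \<Rightarrow> bool" where
  "cycle G p \<longleftrightarrow> length p \<ge> 3 \<and> path G (hd p) p (last p) \<and> {last p, hd p} \<in> edges G"

definition linked :: "('v, 'm) graph_scheme \<Rightarrow> 'v \<Rightarrow> 'v \<Rightarrow> bool" where
  "linked G u v \<longleftrightarrow> (\<exists>p. path G u p v)"

text \<open>Connected components are identified with their vertex sets.\<close>

definition components :: "('v, 'm) graph_scheme \<Rightarrow> 'v set set" where
  "components G = {{v \<in> verts G. linked G u v} | u. u \<in> verts G}"

definition tree :: "('v, 'm) graph_scheme \<Rightarrow> bool" where
  "tree G \<longleftrightarrow> simple_graph G \<and> verts G \<noteq> {} \<and>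
     (\<forall>u \<in> verts G. \<forall>v \<in> verts G. linked G u v) \<and> (\<nexists>p. cycle G p)"

definition leaves :: "('v, 'm) graph_scheme \<Rightarrow> 'v set" where
  "leaves G = {v \<in> verts G. degree G v = 1}"

definition inner_verts :: "('v, 'm) graph_scheme \<Rightarrow> 'v set" where
  "inner_verts G = verts G - leaves G"

section \<open>Rooted trees\<close>

record 'v rooted_graph = "'v graph" +
  root :: 'v

text \<open>The single-vertex tree is admitted: it is the rooted tree with empty leaf set, which makes
  the empty triple set consistent with empty closure.\<close>

definition rooted_tree :: "'v rooted_graph \<Rightarrow> bool" where
  "rooted_tree T \<longleftrightarrow> tree T \<and> root T \<in> inner_verts T \<and>
     (\<forall>v \<in> inner_verts T - {root T}. degree T v \<ge> 3)"

text \<open>Paths in a tree are unique, so the existential quantifiers just name the path from \<open>a\<close> to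
  \<open>b\<close> and the path from \<open>c\<close> to the root.\<close>

definition displays :: "'v rooted_graph \<Rightarrow> 'v \<Rightarrow> 'v \<Rightarrow> 'v \<Rightarrow> bool" where
  "displays T a b c \<longleftrightarrow> distinct [a, b, c] \<and> {a, b, c} \<subseteq> leaves T \<and>
     (\<exists>p q. path T a p b \<and> path T c q (root T) \<and> set p \<inter> set q = {})"

section \<open>Triple sets\<close>

text \<open>The triple \<open>ab|c\<close> is encoded as \<open>({a, b}, c)\<close>, so that \<open>ab|c = ba|c\<close>.\<close>

type_synonym 'a triple = "'a set \<times> 'a"

definition trip :: "'a \<Rightarrow> 'a \<Rightarrow> 'a \<Rightarrow> 'a triple" where
  "trip a b c = ({a, b}, c)"

definition triple_set :: "'a triple set \<Rightarrow> bool" where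
  "triple_set R \<longleftrightarrow> R \<subseteq> {trip a b c | a b c. distinct [a, b, c]}"

definition leaf_set :: "'a triple set \<Rightarrow> 'a set" where
  "leaf_set R = (\<Union>(P, c) \<in> R. insert c P)"

text \<open>Trees for triples over \<open>'a\<close> have vertices in \<open>'a + nat\<close>: the leaf \<open>a\<close> is the vertex
  \<open>Inl a\<close>, and the summand \<open>nat\<close> guarantees enough inner vertices when \<open>'a\<close> is finite.\<close>

definition displayed_triples :: "('a + nat) rooted_graph \<Rightarrow> 'a triple set" where
  "displayed_triples T = {trip a b c | a b c. displays T (Inl a) (Inl b) (Inl c)}"

definition consistent :: "'a triple set \<Rightarrow> bool" where
  "consistent R \<longleftrightarrow> (\<exists>T. rooted_tree T \<and> R \<subseteq> displayed_triples T)"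

definition cl :: "'a triple set \<Rightarrow> 'a triple set" where
  "cl R = \<Inter>{displayed_triples T | T.
     rooted_tree T \<and> leaves T = Inl ` leaf_set R \<and> R \<subseteq> displayed_triples T}"

section \<open>Ahographs and maximal splits\<close>

definition ahograph :: "'a triple set \<Rightarrow> 'a set \<Rightarrow> 'a graph" where
  "ahograph S L = \<lparr> verts = L,
     edges = {{x, y} | x y. x \<in> L \<and> y \<in> L \<and> x \<noteq> y \<and> (\<exists>z \<in> L. trip x y z \<in> S)} \<rparr>"

text \<open>The unordered pair is named so that its first component contains \<open>a, b\<close>; \<open>A \<noteq> B\<close> is needed
  for there to be two components.\<close>

definition split_pairs :: "'a triple \<Rightarrow> 'a triple set \<Rightarrow> 'a set set set" where
  "split_pairs r S = {{A, B} | A B. A \<subseteq> leaf_set S \<and> B \<subseteq> leaf_set S \<and> A \<noteq> B \<and>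
     components (ahograph S (A \<union> B)) = {A, B} \<and> fst r \<subseteq> A \<and> snd r \<in> B}"

definition max_split :: "'a triple \<Rightarrow> 'a triple set \<Rightarrow> 'a set set" where
  "max_split r S = (THE p. is_arg_max (\<lambda>q. card (\<Union>q)) (\<lambda>q. q \<in> split_pairs r S) p)"

definition max_splits :: "'a triple set \<Rightarrow> 'a triple set \<Rightarrow> 'a set set set" where
  "max_splits S' S = {max_split r S | r. r \<in> S'}"

end

(* Rooted trees are laminar families of clusters: ab|c is displayed iff some cluster contains a and b
   but not c.  If a laminar family H separates every triple of S and |M| >= 2, then [S, M] is
   disconnected, because a maximal proper trace of a cluster of H on M is a union of components.
   Consequently, once a vertex set M containing a, b, c has every vertex connected to a or to c, and b
   to a, it is automatically split into exactly two components; such sets are closed under union, and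
   their union is the maximal split.

   A triple ab|c of the closure has such a set (Bryant and Steel): starting from all leaves, shrink M
   to the union of the components of a and c as long as b stays connected to a.  If this never
   stabilises, a tree displaying R but not ab|c is assembled from the discarded components.

   Adding to a split of cl R the R-splits of the triples behind its edges yields a larger split of R,
   so maximal splits with respect to R and cl R agree.  Finally the side A of a maximal split of R
   cannot be connected by triples inside A alone, so some xy|z in R with x, y in A has z on the other
   side, and this triple has the same maximal split. *)

theory Submission
  imports Defs
begin

section \<open>Paths in trees\<close>

lemma path_ConsI:
  assumes "path G v p w" "{u, v} \<in> edges G" "u \<in> verts G" "u \<notin> set p"
  shows "path G u (u # p) w"
  using assms by (auto simp: path_def successively_Cons)

lemma path_ConsD:
  assumes "path G u (u # p) w" "p \<noteq> []"
  shows "path G (hd p) p w" "{u, hd p} \<in> edges G" "u \<notin> set p"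
  using assms by (auto simp: path_def successively_Cons)

lemma path_prefix: "path G u (xs @ v # ys) w \<Longrightarrow> path G u (xs @ [v]) v"
  by (auto simp: path_def successively_append_iff hd_append split: if_splits)

lemma path_suffix: "path G u (xs @ v # ys) w \<Longrightarrow> path G v (v # ys) w"
  by (auto simp: path_def successively_append_iff)

lemma path_rev: "path G u p v \<Longrightarrow> path G v (rev p) u"
  by (auto simp: path_def hd_rev last_rev insert_commute)

lemma path_endpoints: "path G u p v \<Longrightarrow> u \<in> set p \<and> v \<in> set p"
  by (auto simp: path_def)

lemma path_append:
  assumes "path G u (xs @ [v]) v" "path G v (v # ys) w" "set xs \<inter> set ys = {}" "v \<notin> set xs"
  shows "path G u (xs @ v # ys) w"
  using assms by (auto simp: path_def successively_append_iff hd_append split: if_splits)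

text \<open>Only the target of a step is constrained, so the start of a walk must be placed in
  \<open>X\<close> separately. Walks compose by transitivity alone, whereas gluing paths requires
  disjointness.\<close>

definition step_in :: "('v, 'm) graph_scheme \<Rightarrow> 'v set \<Rightarrow> 'v \<Rightarrow> 'v \<Rightarrow> bool" where
  "step_in G X x y \<longleftrightarrow> {x, y} \<in> edges G \<and> y \<in> X"

text \<open>Loop erasure: when the walk returns to a vertex of the path built so far, the path is
  cut back there, and it stays inside \<open>X\<close>.\<close>

lemma path_of_walk:
  assumes "(step_in G X)\<^sup>*\<^sup>* u v" "u \<in> X" "X \<subseteq> verts G"
  shows "\<exists>p. path G u p v \<and> set p \<subseteq> X"
  using assms(1)
proof (induction rule: rtranclp_induct)
  case base
  have "path G u [u] u" using assms by (auto simp: path_def)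
  then show ?case using assms by (intro exI[of _ "[u]"]) auto
next
  case (step y z)
  then obtain p where p: "path G u p y" "set p \<subseteq> X" by blast
  show ?case
  proof (cases "z \<in> set p")
    case True
    then obtain xs ys where e: "p = xs @ z # ys" by (meson split_list)
    with p path_prefix have "path G u (xs @ [z]) z" by fast
    then show ?thesis using p e by (intro exI[of _ "xs @ [z]"]) auto
  next
    case False
    have "path G u (p @ [z]) z"
      using False p step(2) assms(3) by (auto simp: path_def step_in_def successively_append_iff)
    then show ?thesis using p step(2) by (intro exI[of _ "p @ [z]"]) (auto simp: step_in_def)
  qed
qed

lemma walk_of_path:
  assumes "path G u p v" "set p \<subseteq> X"
  shows "(step_in G X)\<^sup>*\<^sup>* u v"
  using assms
proof (induction p arbitrary: u)
  case Nil
  then show ?case by (simp add: path_def)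
next
  case (Cons w p)
  have u: "w = u" using Cons.prems by (simp add: path_def)
  show ?case
  proof (cases "p = []")
    case True
    then show ?thesis using Cons.prems u by (simp add: path_def)
  next
    case False
    note d = path_ConsD[OF Cons.prems(1)[unfolded u] False]
    have "(step_in G X)\<^sup>*\<^sup>* (hd p) v" using Cons.IH[OF d(1)] Cons.prems by auto
    moreover have "step_in G X u (hd p)" using d False Cons.prems(2) hd_in_set[of p] by (auto simp: step_in_def)
    ultimately show ?thesis by (rule converse_rtranclp_into_rtranclp[rotated])
  qed
qed

text \<open>Where two paths first branch, following one to \<open>v\<close> and the other back joins
  the two successors while avoiding \<open>u\<close>; adding \<open>u\<close> closes a
  cycle.\<close>

lemma path_unique:
  assumes "\<nexists>p. cycle G p" "path G u p v" "path G u q v"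
  shows "p = q"
  using assms(2,3)
proof (induction p arbitrary: u q)
  case Nil
  then show ?case by (simp add: path_def)
next
  case (Cons w p)
  have w: "w = u" using Cons.prems by (simp add: path_def)
  obtain q' where q: "q = u # q'" using Cons.prems by (cases q) (auto simp: path_def)
  have un: "u \<notin> set p" "u \<notin> set q'" using Cons.prems q w by (auto simp: path_def)
  have iff: "p = [] \<longleftrightarrow> q' = []"
    using Cons.prems q w un by (auto simp: path_def split: if_splits)
  show ?case
  proof (cases "p = []")
    case True
    then show ?thesis using iff q w by simp
  next
    case False
    then have q'0: "q' \<noteq> []" using iff by simp
    note dp = path_ConsD[OF Cons.prems(1)[unfolded w] False]
    note dq = path_ConsD[OF Cons.prems(2)[unfolded q] q'0]
    have "hd p = hd q'"
    proof (rule ccontr)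
      assume ne: "hd p \<noteq> hd q'"
      let ?X = "set p \<union> set q'"
      have X: "?X \<subseteq> verts G" using dp(1) dq(1) by (auto simp: path_def)
      have "(step_in G ?X)\<^sup>*\<^sup>* (hd p) v" using walk_of_path[OF dp(1)] by simp
      moreover have "(step_in G ?X)\<^sup>*\<^sup>* v (hd q')" using walk_of_path[OF path_rev[OF dq(1)]] by simp
      ultimately have "(step_in G ?X)\<^sup>*\<^sup>* (hd p) (hd q')" by simp
      then obtain r where r: "path G (hd p) r (hd q')" "set r \<subseteq> ?X"
        using path_of_walk X False by (metis UnI1 hd_in_set)
      have ur: "u \<notin> set r" using r un by auto
      have "u \<in> verts G" using Cons.prems(2) by (auto simp: path_def)
      then have pr: "path G u (u # r) (hd q')" using path_ConsI[OF r(1) dp(2)] ur by simp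
      obtain x r' where r': "r = x # r'" using r by (cases r) (auto simp: path_def)
      \<comment> \<open>The endpoints of \<open>r\<close> differ, so together with \<open>u\<close>
        there are the three vertices that a cycle requires.\<close>
      have "r' \<noteq> []" using r ne r' by (auto simp: path_def)
      then have "length (u # r) \<ge> 3" using r' by (cases r') auto
      moreover have "last (u # r) = hd q'" using pr by (simp add: path_def)
      ultimately have "cycle G (u # r)" using pr dq(2) by (simp add: cycle_def insert_commute)
      then show False using assms(1) by blast
    qed
    then have "p = q'" using Cons.IH[OF dp(1)] dq(1) by simp
    then show ?thesis using q w by simp
  qed
qed

section \<open>Clusters of rooted trees\<close>

text \<open>A reflexive relation whose second argument is the vertex nearer to the root. The cluster
  of \<open>v\<close> consists of the leaves \<open>x\<close> related to it.\<close>

definition ancestor :: "'v rooted_graph \<Rightarrow> 'v \<Rightarrow> 'v \<Rightarrow> bool" where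
  "ancestor T x v \<longleftrightarrow> (\<exists>p. path T x p (root T) \<and> v \<in> set p)"

context
  fixes T :: "'v rooted_graph"
  assumes T: "rooted_tree T"
begin

lemma no_cycle: "\<nexists>p. cycle T p"
  using T by (simp add: rooted_tree_def tree_def)

lemma root_path: "x \<in> verts T \<Longrightarrow> \<exists>p. path T x p (root T)"
  using T by (auto simp: rooted_tree_def tree_def linked_def inner_verts_def)

lemma ancestor_iff: "path T x p (root T) \<Longrightarrow> ancestor T x v \<longleftrightarrow> v \<in> set p"
  unfolding ancestor_def using path_unique[OF no_cycle] by blast

lemma ancestor_split:
  assumes "ancestor T x v"
  obtains xs ys where "path T x (xs @ v # ys) (root T)" "path T x (xs @ [v]) v" "path T v (v # ys) (root T)"
  using assms path_prefix path_suffix unfolding ancestor_def by (metis split_list)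

lemma ancestor_trans:
  assumes "ancestor T x v" "ancestor T v w"
  shows "ancestor T x w"
proof -
  obtain xs ys where *: "path T x (xs @ v # ys) (root T)" "path T v (v # ys) (root T)"
    using assms(1) by (rule ancestor_split)
  then have "w \<in> set (v # ys)" using assms(2) ancestor_iff by blast
  then show ?thesis using ancestor_iff[OF *(1)] by auto
qed

text \<open>Both vertices lie on the unique path from \<open>x\<close> to the root, and the one met
  first has the other above it. This makes clusters laminar.\<close>

lemma ancestor_comparable:
  assumes "ancestor T x v" "ancestor T x w"
  shows "ancestor T v w \<or> ancestor T w v"
proof -
  obtain xs ys where *: "path T x (xs @ v # ys) (root T)" "path T v (v # ys) (root T)"
    using assms(1) by (rule ancestor_split)
  then consider "w \<in> set (v # ys)" | "w \<in> set xs" using assms(2) ancestor_iff[OF *(1)] by auto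
  then show ?thesis
  proof cases
    case 1
    then show ?thesis using ancestor_iff[OF *(2)] by blast
  next
    case 2
    then obtain as bs where "xs = as @ w # bs" by (meson split_list)
    then have "path T w (w # bs @ v # ys) (root T)" using path_suffix[of T x as w "bs @ v # ys"] *(1) by simp
    then show ?thesis by (auto simp: ancestor_def)
  qed
qed

text \<open>The vertex of the path from \<open>a\<close> to \<open>b\<close> nearest to the root
  serves as \<open>v\<close>. Conversely, the ways up from \<open>a\<close> and from
  \<open>b\<close> to \<open>v\<close> cannot touch the path from \<open>c\<close> to the
  root.\<close>

lemma displays_iff:
  "displays T a b c \<longleftrightarrow> distinct [a, b, c] \<and> {a, b, c} \<subseteq> leaves T \<and>
     (\<exists>v. ancestor T a v \<and> ancestor T b v \<and> \<not> ancestor T c v)"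
proof (cases "distinct [a, b, c] \<and> {a, b, c} \<subseteq> leaves T")
  case True
  then have V: "a \<in> verts T" "b \<in> verts T" "c \<in> verts T" by (auto simp: leaves_def)
  obtain q where q: "path T c q (root T)" using root_path V by blast
  have "(\<exists>p. path T a p b \<and> set p \<inter> set q = {}) \<longleftrightarrow>
     (\<exists>v. ancestor T a v \<and> ancestor T b v \<and> \<not> ancestor T c v)" (is "?l \<longleftrightarrow> ?r")
  proof
    assume ?l
    then obtain p where p: "path T a p b" "set p \<inter> set q = {}" by blast
    obtain s where s: "path T a s (root T)" using root_path V by blast
    have "\<exists>x\<in>set s. x \<in> set p" using path_endpoints[OF p(1)] path_endpoints[OF s] by blast
    \<comment> \<open>Beyond \<open>v\<close> the path from \<open>a\<close> to the root avoids
      \<open>p\<close>, so the piece of \<open>p\<close> from \<open>b\<close> to \<open>v\<close>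
      can be prolonged to the root.\<close>
    then obtain xs v ys where s': "s = xs @ v # ys" "v \<in> set p" "\<forall>y\<in>set ys. y \<notin> set p"
      using split_list_last_prop[of s "\<lambda>x. x \<in> set p"] by blast
    have av: "ancestor T a v" using s s' by (auto simp: ancestor_def)
    obtain ps qs where pe: "p = ps @ v # qs" using s' by (meson split_list)
    have "path T b (rev qs @ v # rev ps) a" using path_rev[OF p(1)] pe by simp
    then have 1: "path T b (rev qs @ [v]) v" by (rule path_prefix)
    have 2: "path T v (v # ys) (root T)" using s s' path_suffix by fast
    have "path T b (rev qs @ v # ys) (root T)"
      proof (rule path_append[OF 1 2])
      show "set (rev qs) \<inter> set ys = {}" using s'(3) pe by auto
      show "v \<notin> set (rev qs)" using p(1) pe by (auto simp: path_def)
    qed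
    then have "ancestor T b v" by (auto simp: ancestor_def)
    moreover have "\<not> ancestor T c v" using ancestor_iff[OF q] p s' by auto
    ultimately show ?r using av by blast
  next
    assume ?r
    then obtain v where v: "ancestor T a v" "ancestor T b v" "\<not> ancestor T c v" by blast
    have *: "\<exists>p. path T x p v \<and> set p \<inter> set q = {}" if xv: "ancestor T x v" for x
    proof -
      obtain xs ys where xs: "path T x (xs @ v # ys) (root T)" "path T x (xs @ [v]) v"
        "path T v (v # ys) (root T)" using xv by (rule ancestor_split)
      \<comment> \<open>A vertex \<open>w\<close> shared with \<open>q\<close> is an ancestor of
        \<open>c\<close> and has \<open>v\<close> above it, so \<open>v\<close> would be an ancestor
        of \<open>c\<close>.\<close>
      have "w \<notin> set q" if w: "w \<in> set (xs @ [v])" for w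
      proof
        assume "w \<in> set q"
        then have cw: "ancestor T c w" using q by (auto simp: ancestor_def)
        obtain as bs where as: "xs @ [v] = as @ w # bs" using split_list[OF w] by blast
        then have "path T w (w # bs @ ys) (root T)"
          using path_suffix[of T x as w "bs @ ys"] xs(1) by (metis append.assoc append_Cons append_Nil)
        moreover have "v \<in> set (w # bs)" using as by (metis last_in_set last_appendR last_snoc list.distinct(1))
        ultimately have "ancestor T w v" by (auto simp: ancestor_def)
        then show False using cw v(3) ancestor_trans by blast
      qed
      then show ?thesis using xs by blast
    qed
    obtain pa where pa: "path T a pa v" "set pa \<inter> set q = {}" using *[OF v(1)] by blast
    obtain pb where pb: "path T b pb v" "set pb \<inter> set q = {}" using *[OF v(2)] by blast
    let ?X = "set pa \<union> set pb"
    have "(step_in T ?X)\<^sup>*\<^sup>* a v" using walk_of_path[OF pa(1)] by simp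
    moreover have "(step_in T ?X)\<^sup>*\<^sup>* v b" using walk_of_path[OF path_rev[OF pb(1)]] by simp
    ultimately have "(step_in T ?X)\<^sup>*\<^sup>* a b" by simp
    moreover have "?X \<subseteq> verts T" using pa pb by (auto simp: path_def)
    moreover have "a \<in> ?X" using path_endpoints[OF pa(1)] by simp
    ultimately obtain p where "path T a p b" "set p \<subseteq> ?X" using path_of_walk by meson
    then show ?l using pa pb by blast
  qed
  \<comment> \<open>Uniqueness of paths allows the path from \<open>c\<close> to the root to be
    fixed as \<open>q\<close>.\<close>
  moreover have "displays T a b c \<longleftrightarrow> (\<exists>p. path T a p b \<and> set p \<inter> set q = {})"
    unfolding displays_def using True q path_unique[OF no_cycle q] by blast
  ultimately show ?thesis using True by blast
next
  case False
  then show ?thesis by (auto simp: displays_def)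
qed

end

section \<open>Laminar families and the triples they separate\<close>

definition laminar :: "'a set set \<Rightarrow> bool" where
  "laminar H \<longleftrightarrow> (\<forall>C\<in>H. \<forall>D\<in>H. C \<subseteq> D \<or> D \<subseteq> C \<or> C \<inter> D = {})"

definition separates :: "'a set set \<Rightarrow> 'a \<Rightarrow> 'a \<Rightarrow> 'a \<Rightarrow> bool" where
  "separates H x y z \<longleftrightarrow> (\<exists>C\<in>H. x \<in> C \<and> y \<in> C \<and> z \<notin> C)"

lemma laminarD: "laminar H \<Longrightarrow> C \<in> H \<Longrightarrow> D \<in> H \<Longrightarrow> C \<subseteq> D \<or> D \<subseteq> C \<or> C \<inter> D = {}"
  by (simp add: laminar_def)

lemma trip_eq_iff: "trip x y z = trip x' y' z' \<longleftrightarrow> z = z' \<and> (x = x' \<and> y = y' \<or> x = y' \<and> y = x')"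
  by (auto simp: trip_def doubleton_eq_iff)

lemma trip_commute: "trip x y z = trip y x z"
  by (simp add: trip_def insert_commute)

lemma displays_commute: "displays T a b c \<Longrightarrow> displays T b a c"
  unfolding displays_def using path_rev[of T a _ b] by (fastforce simp: set_rev)

lemma trip_in_displayed_triples:
  "trip x y z \<in> displayed_triples T \<longleftrightarrow> displays T (Inl x) (Inl y) (Inl z)"
  unfolding displayed_triples_def using displays_commute by (auto simp: trip_eq_iff)

lemma rooted_tree_laminar:
  fixes T :: "('a + nat) rooted_graph"
  assumes T: "rooted_tree T"
  obtains H where "laminar H" "\<And>x y z. trip x y z \<in> displayed_triples T \<Longrightarrow> separates H x y z"
proof
  \<comment> \<open>Here \<open>v\<close> runs over the whole type; a value that is no vertex yields
    the empty set, which does not disturb laminarity.\<close>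
  let ?H = "(\<lambda>v. {x. ancestor T (Inl x) v}) ` UNIV"
  show "laminar ?H"
    unfolding laminar_def using ancestor_comparable[OF T] ancestor_trans[OF T] by blast
  show "separates ?H x y z" if "trip x y z \<in> displayed_triples T" for x y z
    using that displays_iff[OF T] by (auto simp: trip_in_displayed_triples separates_def)
qed

section \<open>Trees from hierarchies\<close>

text \<open>Once the cycle is rotated to begin at \<open>x\<close>, the two neighbours are the ends
  of the remaining list, which has at least two entries.\<close>

lemma cycle_neighbours:
  assumes "cycle G p" "x \<in> set p"
  obtains y z where "y \<in> set p" "z \<in> set p" "y \<noteq> z" "y \<noteq> x" "z \<noteq> x" "{x, y} \<in> edges G" "{x, z} \<in> edges G"
proof -
  obtain as bs where p: "p = as @ x # bs" using assms(2) by (meson split_list)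
  have d: "distinct p" "successively (\<lambda>x y. {x, y} \<in> edges G) p" "length p \<ge> 3" "{last p, hd p} \<in> edges G"
    using assms(1) by (simp_all add: cycle_def path_def)
  define q where "q = bs @ as"
  have dq: "distinct (x # q)" "length q \<ge> 2" "set p = insert x (set q)"
    using d p by (auto simp: q_def)
  have "{x, hd q} \<in> edges G"
    using d p by (cases bs) (auto simp: q_def successively_append_iff successively_Cons hd_append insert_commute split: if_splits)
  moreover have "{x, last q} \<in> edges G"
    using d p by (cases as rule: rev_cases) (auto simp: q_def successively_append_iff successively_Cons hd_append insert_commute split: if_splits)
  moreover have "hd q \<noteq> last q"
    using dq by (cases q) auto
  moreover have "hd q \<in> set q" "last q \<in> set q" using dq by (cases q; simp)+
  ultimately show thesis using that[of "hd q" "last q"] dq by auto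
qed

text \<open>The Hasse diagram of a hierarchy, with vertices naming the clusters through \<open>h\<close>.\<close>

locale hierarchy =
  fixes V :: "'v set" and h :: "'v \<Rightarrow> 'a set" and r :: 'v
  assumes fin: "finite V" "finite (h r)" and inj: "inj_on h V"
    and lam: "laminar (h ` V)" and ne: "v \<in> V \<Longrightarrow> h v \<noteq> {}"
    and r: "r \<in> V" and below_r: "v \<in> V \<Longrightarrow> h v \<subseteq> h r"
    and singles: "x \<in> h r \<Longrightarrow> {x} \<in> h ` V" and nontrivial: "h r \<noteq> {x}"
begin

definition covers :: "'v \<Rightarrow> 'v \<Rightarrow> bool" where
  "covers w u \<longleftrightarrow> u \<in> V \<and> w \<in> V \<and> h u \<subset> h w \<and> \<not> (\<exists>v\<in>V. h u \<subset> h v \<and> h v \<subset> h w)"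

definition T :: "'v rooted_graph" where
  "T = \<lparr> verts = V, edges = {{u, w} | u w. covers w u}, root = r \<rparr>"

lemma T_simps: "verts T = V" "root T = r" "{u, w} \<in> edges T \<longleftrightarrow> covers w u \<or> covers u w"
  by (auto simp: T_def doubleton_eq_iff)

lemma finite_h: "v \<in> V \<Longrightarrow> finite (h v)"
  using below_r fin(2) finite_subset by blast

lemma comparable: "u \<in> V \<Longrightarrow> v \<in> V \<Longrightarrow> x \<in> h u \<Longrightarrow> x \<in> h v \<Longrightarrow> h u \<subseteq> h v \<or> h v \<subseteq> h u"
  using lam laminarD[of "h ` V" "h u" "h v"] by blast

lemma h_eq: "u \<in> V \<Longrightarrow> v \<in> V \<Longrightarrow> h u = h v \<Longrightarrow> u = v"
  using inj by (simp add: inj_on_def)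

text \<open>By laminarity the clusters containing the nonempty \<open>h u\<close> form a chain, so a
  minimal strict superset is the least one. Hence parents are unique.\<close>

lemma covers_least:
  assumes "covers w u" "v \<in> V" "h u \<subset> h v"
  shows "h w \<subseteq> h v"
proof -
  obtain x where "x \<in> h u" using assms(1) ne[of u] unfolding covers_def by blast
  then have "h w \<subseteq> h v \<or> h v \<subseteq> h w" using assms comparable[of w v x] by (auto simp: covers_def)
  then show ?thesis using assms by (auto simp: covers_def)
qed

lemma covers_unique: "covers w u \<Longrightarrow> covers w' u \<Longrightarrow> w = w'"
  using covers_least[of w u w'] covers_least[of w' u w] h_eq by (auto simp: covers_def)

lemma ex_cover:
  assumes "u \<in> V" "u \<noteq> r"
  shows "\<exists>w. covers w u"
proof -
  let ?P = "\<lambda>w. w \<in> V \<and> h u \<subset> h w"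
  have "h u \<subset> h r" using below_r[OF assms(1)] h_eq[OF assms(1) r] assms(2) by blast
  then have "?P r" using r by simp
  from ex_has_least_nat[of ?P, OF this, of "\<lambda>w. card (h w)"]
  obtain w where w: "?P w \<and> (\<forall>v. ?P v \<longrightarrow> card (h w) \<le> card (h v))" ..
  have "\<not> h v \<subset> h w" if "?P v" for v
    using w that psubset_card_mono[OF finite_h[of w], of "h v"] by (meson not_le)
  then show ?thesis using w assms unfolding covers_def by blast
qed

text \<open>Among the proper subclusters of \<open>h w\<close> that contain \<open>x\<close>, of
  which \<open>{x}\<close> is one, a largest is a child.\<close>

lemma ex_child_containing:
  assumes "w \<in> V" "x \<in> h w" "h w \<noteq> {x}"
  shows "\<exists>u. covers w u \<and> x \<in> h u"
proof -
  define P where "P u \<longleftrightarrow> u \<in> V \<and> x \<in> h u \<and> h u \<subset> h w" for u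
  have "{x} \<in> h ` V" using singles below_r assms by blast
  then obtain s where "h s = {x}" "s \<in> V" by (metis imageE)
  then have "P s" using assms by (auto simp: P_def)
  moreover have "\<forall>v. P v \<longrightarrow> card (h v) < card (h w)"
    using psubset_card_mono[OF finite_h[OF assms(1)]] by (simp add: P_def)
  ultimately have "\<exists>u. P u \<and> (\<forall>v. P v \<longrightarrow> card (h v) \<le> card (h u))"
    by (rule ex_has_greatest_nat)
  then obtain u where u: "P u \<and> (\<forall>v. P v \<longrightarrow> card (h v) \<le> card (h u))" by blast
  have "\<not> h u \<subset> h v" if "v \<in> V" "h v \<subset> h w" for v
  proof
    assume *: "h u \<subset> h v"
    then have "P v" using that conjunct1[OF u] by (auto simp: P_def)
    then have "card (h v) \<le> card (h u)" using u by simp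
    then show False using psubset_card_mono[OF finite_h[OF that(1)] *] by simp
  qed
  then have "covers w u" using conjunct1[OF u] assms(1) by (auto simp: covers_def P_def)
  then show ?thesis using conjunct1[OF u] by (auto simp: P_def)
qed

text \<open>The path climbs from child to parent; the induction is on the number of elements of the
  root cluster that \<open>h u\<close> still misses. Listing its vertices identifies ancestors with
  containing clusters.\<close>

lemma root_path_T:
  assumes "u \<in> V"
  shows "\<exists>p. path T u p r \<and> set p = {w \<in> V. h u \<subseteq> h w}"
  using assms
proof (induction "card (h r) - card (h u)" arbitrary: u rule: less_induct)
  case less
  show ?case
  proof (cases "u = r")
    case True
    have "path T u [u] r" using True r by (simp add: path_def T_simps)
    moreover have "w = u" if "w \<in> V" "h u \<subseteq> h w" for w
      unfolding True by (rule h_eq[OF that(1) r]) (use below_r[OF that(1)] that(2) True in blast)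
    then have "{w \<in> V. h u \<subseteq> h w} = {u}" using True r by auto
    ultimately show ?thesis by (intro exI[of _ "[u]"]) simp
  next
    case False
    then obtain w where w: "covers w u" using ex_cover less.prems by blast
    then have wV: "w \<in> V" "h u \<subset> h w" by (auto simp: covers_def)
    have "card (h u) < card (h w)" "card (h w) \<le> card (h r)"
      using psubset_card_mono[OF finite_h[OF wV(1)] wV(2)] card_mono[OF fin(2) below_r[OF wV(1)]] .
    then have "card (h r) - card (h w) < card (h r) - card (h u)" by linarith
    from less.hyps[OF this wV(1)]
    obtain p where p: "path T w p r" "set p = {v \<in> V. h w \<subseteq> h v}" by blast
    \<comment> \<open>The cover \<open>w\<close> is least, so whatever lies strictly above
      \<open>h u\<close> already contains \<open>h w\<close>.\<close>
    have eq: "{v \<in> V. h u \<subseteq> h v} = insert u {v \<in> V. h w \<subseteq> h v}"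
    proof -
      have "h u \<subseteq> h v \<longleftrightarrow> v = u \<or> h w \<subseteq> h v" if v: "v \<in> V" for v
      proof
        assume "h u \<subseteq> h v"
        then have "h u = h v \<or> h u \<subset> h v" by blast
        then show "v = u \<or> h w \<subseteq> h v"
          using h_eq[OF less.prems v] covers_least[OF w v] by blast
      qed (use wV in auto)
      then show ?thesis using less.prems by auto
    qed
    have "path T u (u # p) r"
      using path_ConsI[OF p(1), of u] p(2) w less.prems wV by (auto simp: T_simps)
    then show ?thesis using p eq by (intro exI[of _ "u # p"]) simp
  qed
qed

text \<open>Both cycle neighbours of a vertex with smallest cluster would be its parents, but
  parents are unique.\<close>

lemma no_cycle_T: "\<not> cycle T p"
proof
  assume c: "cycle T p"
  then have pV: "set p \<subseteq> V" and "hd p \<in> set p" by (auto simp: cycle_def path_def T_simps)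
  from ex_has_least_nat[of "\<lambda>x. x \<in> set p", OF this(2), of "\<lambda>x. card (h x)"]
  obtain x where x': "x \<in> set p \<and> (\<forall>y. y \<in> set p \<longrightarrow> card (h x) \<le> card (h y))" ..
  then have x: "x \<in> set p" by simp
  obtain y z where yz: "y \<in> set p" "z \<in> set p" "y \<noteq> z" "{x, y} \<in> edges T" "{x, z} \<in> edges T"
    using cycle_neighbours[OF c x] by blast
  have "covers v x" if "v \<in> set p" "{x, v} \<in> edges T" for v
  proof -
    have "\<not> covers x v"
    proof
      assume "covers x v"
      then have "card (h v) < card (h x)" by (auto simp: covers_def intro: psubset_card_mono finite_h)
      then show False using x' that(1) by (meson not_le)
    qed
    then show ?thesis using that by (simp add: T_simps)
  qed
  then show False using yz covers_unique by blast
qed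

lemma tree_T: "tree T"
proof -
  have "linked T u v" if uv: "u \<in> V" "v \<in> V" for u v
  proof -
    obtain p q where p: "path T u p r" and q: "path T v q r" using root_path_T uv by meson
    then have s: "set p \<subseteq> V" "set q \<subseteq> V" by (auto simp: path_def T_simps)
    have "(step_in T V)\<^sup>*\<^sup>* u r" using walk_of_path[OF p s(1)] .
    moreover have "(step_in T V)\<^sup>*\<^sup>* r v" using walk_of_path[OF path_rev[OF q]] s by simp
    ultimately have "(step_in T V)\<^sup>*\<^sup>* u v" by simp
    then show ?thesis using path_of_walk[of T V u v] uv by (auto simp: linked_def T_simps)
  qed
  moreover have "simple_graph T"
    using fin by (auto simp: simple_graph_def T_def covers_def)
  ultimately show ?thesis using no_cycle_T r by (auto simp: tree_def T_simps)
qed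

lemma neighbours_T:
  "u \<in> V \<Longrightarrow> {v \<in> verts T. {u, v} \<in> edges T} = {v. covers v u} \<union> {v. covers u v}"
  by (auto simp: T_simps covers_def)

lemma finite_neighbours: "finite ({v. covers v u} \<union> {v. covers u v})"
  by (rule finite_subset[OF _ fin(1)]) (auto simp: covers_def)

lemma degree_leaf:
  assumes "u \<in> V" "h u = {x}"
  shows "degree T u = 1"
proof -
  have "u \<noteq> r" using assms nontrivial by blast
  then obtain w where "covers w u" using ex_cover assms by blast
  then have "{v. covers v u} = {w}" using covers_unique by blast
  moreover have "{v. covers u v} = {}" using assms ne unfolding covers_def by (metis (mono_tags, lifting) Collect_empty_eq psubsetE subset_singletonD subset_refl)
  ultimately show ?thesis using assms by (simp add: degree_def neighbours_T)
qed

text \<open>A child containing \<open>x\<close> is a proper subset and misses some \<open>y\<close>;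
  a child containing \<open>y\<close> is a second one.\<close>

lemma children:
  assumes "u \<in> V" "\<nexists>x. h u = {x}"
  obtains v w where "covers u v" "covers u w" "v \<noteq> w"
proof -
  obtain x where x: "x \<in> h u" using ne assms by blast
  then obtain v where v: "covers u v" "x \<in> h v" using ex_child_containing assms by metis
  then obtain y where y: "y \<in> h u" "y \<notin> h v" by (auto simp: covers_def)
  then obtain w where "covers u w" "y \<in> h w" using ex_child_containing assms by metis
  then show thesis using that v y by blast
qed

text \<open>Two children and, away from the root, a parent. The bound 2 keeps the root from being a
  leaf.\<close>

lemma degree_inner:
  assumes "u \<in> V" "\<nexists>x. h u = {x}"
  shows "degree T u \<ge> (if u = r then 2 else 3)"
proof -
  obtain v w where vw: "covers u v" "covers u w" "v \<noteq> w" using children[OF assms] .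
  let ?N = "{v. covers v u} \<union> {v. covers u v}"
  have deg: "degree T u = card ?N" using assms by (simp add: degree_def neighbours_T)
  show ?thesis
  proof (cases "u = r")
    case True
    have "card {v, w} \<le> card ?N" using vw finite_neighbours by (intro card_mono) auto
    then show ?thesis using True vw deg by simp
  next
    case False
    then obtain t where t: "covers t u" using ex_cover assms by blast
    then have "t \<noteq> v" "t \<noteq> w" using vw by (auto simp: covers_def)
    moreover have "card {t, v, w} \<le> card ?N" using vw t finite_neighbours by (intro card_mono) auto
    ultimately show ?thesis using False vw deg by simp
  qed
qed

lemma leaves_T: "leaves T = {u \<in> V. \<exists>x. h u = {x}}"
  using degree_leaf degree_inner by (fastforce simp: leaves_def T_simps split: if_splits)

lemma rooted_tree_T: "rooted_tree T"
proof -
  have "3 \<le> degree T v" if "v \<in> V" "\<nexists>x. h v = {x}" "v \<noteq> r" for v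
    using degree_inner[OF that(1,2)] that(3) by simp
  moreover have "\<nexists>x. h r = {x}" using nontrivial by blast
  ultimately show ?thesis
    unfolding rooted_tree_def inner_verts_def leaves_T T_simps using tree_T r by blast
qed

lemma ancestor_T:
  assumes "u \<in> V"
  shows "ancestor T u v \<longleftrightarrow> v \<in> V \<and> h u \<subseteq> h v"
proof -
  obtain p where "path T u p (root T)" "set p = {w \<in> V. h u \<subseteq> h w}"
    using root_path_T[OF assms] unfolding T_simps by blast
  then show ?thesis using ancestor_iff[OF rooted_tree_T] by simp
qed

end

text \<open>Converse of \<open>rooted_tree_laminar\<close>: the family is completed by
  \<open>L\<close> as root and by the singletons as leaves, and its Hasse diagram is the
  tree.\<close>

lemma hierarchy_tree:
  fixes L :: "'a set"
  assumes L: "finite L" "x0 \<in> L" "L \<noteq> {x0}" and H: "H \<subseteq> Pow L" "laminar H"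
  obtains T :: "('a + nat) rooted_graph" where "rooted_tree T" "leaves T = Inl ` L"
    "\<forall>x y z. trip x y z \<in> displayed_triples T \<longleftrightarrow>
       distinct [x, y, z] \<and> {x, y, z} \<subseteq> L \<and> separates H x y z"
proof -
  define F where "F = insert L (H \<union> (\<lambda>x. {x}) ` L) - {{}}"
  have F_sub: "C \<subseteq> L" "C \<noteq> {}" if "C \<in> F" for C using that H(1) by (auto simp: F_def)
  have LF: "L \<in> F" using L(2) by (auto simp: F_def)
  have single: "{x} \<in> F \<longleftrightarrow> x \<in> L" for x using H(1) by (auto simp: F_def)
  \<comment> \<open>The added sets separate nothing new: \<open>L\<close> contains \<open>z\<close>,
    and a singleton cannot contain both \<open>x\<close> and \<open>y\<close>.\<close>
  have sepF: "separates F x y z \<longleftrightarrow> separates H x y z" if "x \<noteq> y" "z \<in> L" for x y z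
    using that unfolding F_def separates_def by auto
  have finF: "finite F" using F_sub(1) L(1) by (intro finite_subset[of F "Pow L"]) auto
  have lamF: "laminar F"
    unfolding laminar_def
  proof (intro ballI)
    fix C D assume CD: "C \<in> F" "D \<in> F"
    have "C \<subseteq> L" "D \<subseteq> L" using CD F_sub(1) by auto
    moreover have "C = L \<or> D = L \<or> (\<exists>x. C = {x}) \<or> (\<exists>x. D = {x}) \<or> C \<in> H \<and> D \<in> H"
      using CD unfolding F_def by blast
    ultimately show "C \<subseteq> D \<or> D \<subseteq> C \<or> C \<inter> D = {}"
      using laminarD[OF H(2), of C D] by (elim disjE exE) auto
  qed
  obtain g :: "'a set \<Rightarrow> nat" where g: "inj_on g F" using finite_imp_inj_to_nat_seg[OF finF] by blast
  \<comment> \<open>A singleton must be named by its leaf \<open>Inl x\<close>, as the encoding of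
    displayed triples demands; all other clusters get inner names through \<open>g\<close>.\<close>
  define f :: "'a set \<Rightarrow> 'a + nat" where "f C = (if is_singleton C then Inl (the_elem C) else Inr (g C))" for C
  have f1: "f {x} = Inl x" for x by (simp add: f_def)
  have injf: "inj_on f F"
  proof (rule inj_onI)
    fix C D assume CD: "C \<in> F" "D \<in> F" "f C = f D"
    then show "C = D"
      using inj_onD[OF g, of C D] is_singleton_the_elem[of C] is_singleton_the_elem[of D]
      by (simp add: f_def split: if_splits)
  qed
  define h where "h = the_inv_into F f"
  have hf: "h (f C) = C" if "C \<in> F" for C using the_inv_into_f_f[OF injf that] by (simp add: h_def)
  have hV: "h ` f ` F = F" using hf by force
  interpret hierarchy "f ` F" h "f L"
  proof
    show "inj_on h (f ` F)" using hf by (auto intro!: inj_onI)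
    show "laminar (h ` f ` F)" unfolding hV by (rule lamF)
    show "h v \<noteq> {}" if "v \<in> f ` F" for v using that hf F_sub(2) by auto
    show "h v \<subseteq> h (f L)" if "v \<in> f ` F" for v unfolding hf[OF LF] using that F_sub(1)[THEN subsetD] by (auto simp: hf)
    show "{x} \<in> h ` f ` F" if "x \<in> h (f L)" for x using that unfolding hV hf[OF LF] single .
    show "h (f L) \<noteq> {x}" for x unfolding hf[OF LF] using L by auto
    show "finite (h (f L))" using hf[OF LF] L by simp
    show "f L \<in> f ` F" using LF by blast
  qed (use finF in auto)
  have lv: "leaves T = Inl ` L"
  proof
    show "leaves T \<subseteq> Inl ` L" unfolding leaves_T using hf single f1 by fastforce
    show "Inl ` L \<subseteq> leaves T"
    proof
      fix v :: "'a + nat" assume "v \<in> Inl ` L"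
      then obtain x where x: "v = Inl x" "{x} \<in> F" using single by auto
      then have "v = f {x}" by (simp add: f1)
      then show "v \<in> leaves T" unfolding leaves_T using x hf[OF x(2)] by blast
    qed
  qed
  have anc: "ancestor T (Inl x) v \<longleftrightarrow> v \<in> f ` F \<and> x \<in> h v" if "x \<in> L" for x v
  proof -
    have x: "{x} \<in> F" using that single by blast
    then have "ancestor T (f {x}) v \<longleftrightarrow> v \<in> f ` F \<and> h (f {x}) \<subseteq> h v"
      by (intro ancestor_T imageI)
    then show ?thesis unfolding hf[OF x] unfolding f1 by simp
  qed
  have "trip x y z \<in> displayed_triples T \<longleftrightarrow>
       distinct [x, y, z] \<and> {x, y, z} \<subseteq> L \<and> separates H x y z" for x y z
  proof (cases "distinct [x, y, z] \<and> {x, y, z} \<subseteq> L")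
    case True
    then have "(\<exists>v. ancestor T (Inl x) v \<and> ancestor T (Inl y) v \<and> \<not> ancestor T (Inl z) v) \<longleftrightarrow>
        (\<exists>v\<in>f ` F. x \<in> h v \<and> y \<in> h v \<and> z \<notin> h v)" using anc by auto
    also have "\<dots> \<longleftrightarrow> separates F x y z" unfolding separates_def using hf by simp
    also have "\<dots> \<longleftrightarrow> separates H x y z" using sepF True by simp
    finally show ?thesis using True
      by (auto simp: trip_in_displayed_triples displays_iff[OF rooted_tree_T] lv)
  next
    case False
    then show ?thesis by (auto simp: trip_in_displayed_triples displays_def lv)
  qed
  then show thesis using that[OF rooted_tree_T lv] by blast
qed

section \<open>Components of Ahographs and maximal splits\<close>

definition adj :: "'a triple set \<Rightarrow> 'a set \<Rightarrow> 'a \<Rightarrow> 'a \<Rightarrow> bool" where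
  "adj S M x y \<longleftrightarrow> x \<in> M \<and> y \<in> M \<and> x \<noteq> y \<and> (\<exists>z\<in>M. trip x y z \<in> S)"

text \<open>The restriction to \<open>M\<close> makes the component of a point outside
  \<open>M\<close> empty, so membership certifies that both points lie in \<open>M\<close>.\<close>

definition component :: "'a triple set \<Rightarrow> 'a set \<Rightarrow> 'a \<Rightarrow> 'a set" where
  "component S M x = {y \<in> M. (adj S M)\<^sup>*\<^sup>* x y}"

lemma adj_commute: "adj S M x y \<longleftrightarrow> adj S M y x"
  by (auto simp: adj_def trip_commute)

lemma component_subset: "component S M x \<subseteq> M"
  by (auto simp: component_def)

lemma component_refl: "x \<in> M \<Longrightarrow> x \<in> component S M x"
  by (simp add: component_def)

lemma component_memD: "y \<in> component S M x \<Longrightarrow> x \<in> M \<and> y \<in> M"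
  by (auto simp: component_def adj_def elim: converse_rtranclpE)

lemma component_commute: "y \<in> component S M x \<Longrightarrow> x \<in> component S M y"
proof -
  have "symp (adj S M)" by (simp add: symp_def adj_commute)
  then have "symp (adj S M)\<^sup>*\<^sup>*" by (rule symp_rtranclp)
  then show "y \<in> component S M x \<Longrightarrow> x \<in> component S M y"
    using component_memD[of y S M x] by (auto simp: component_def dest: sympD)
qed

lemma component_trans: "y \<in> component S M x \<Longrightarrow> z \<in> component S M y \<Longrightarrow> z \<in> component S M x"
  by (auto simp: component_def)

lemma component_eq: "y \<in> component S M x \<Longrightarrow> component S M y = component S M x"
  by (meson component_commute component_trans subsetI subset_antisym)

lemma component_disjoint: "component S M x = component S M y \<or> component S M x \<inter> component S M y = {}"
  using component_eq by (metis disjoint_iff)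

lemma adj_component: "adj S M x y \<Longrightarrow> y \<in> component S M x"
  by (simp add: component_def r_into_rtranclp) (simp add: adj_def)

lemma component_if_closed:
  assumes "y \<in> component S M x" "x \<in> N" "\<And>u v. u \<in> N \<Longrightarrow> adj S M u v \<Longrightarrow> v \<in> N"
  shows "y \<in> N"
proof -
  have "(adj S M)\<^sup>*\<^sup>* x y" using assms(1) by (simp add: component_def)
  then show ?thesis by (induction rule: rtranclp_induct) (use assms in auto)
qed

text \<open>Each edge need only be realised as a connection, not as an edge. This allows the passage
  from \<open>cl R\<close> back to \<open>R\<close> on a larger vertex set.\<close>

lemma component_subset_if_adj:
  assumes "\<And>u v. adj S M u v \<Longrightarrow> v \<in> component S' M' u" "M \<subseteq> M'"
  shows "component S M x \<subseteq> component S' M' x"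
proof
  fix y assume y: "y \<in> component S M x"
  then have "x \<in> component S' M' x" using component_memD[OF y] assms(2) by (blast intro: component_refl)
  from component_if_closed[OF y this] show "y \<in> component S' M' x"
    using assms(1) component_trans by fast
qed

lemma component_mono: "S \<subseteq> S' \<Longrightarrow> M \<subseteq> M' \<Longrightarrow> component S M x \<subseteq> component S' M' x"
  by (rule component_subset_if_adj, rule adj_component) (auto simp: adj_def)

lemma components_ahograph: "components (ahograph S M) = component S M ` M"
proof -
  let ?G = "ahograph S M"
  have edge: "{x, y} \<in> edges ?G \<longleftrightarrow> adj S M x y" for x y
    by (auto simp: ahograph_def adj_def doubleton_eq_iff trip_commute)
  have verts: "verts ?G = M" by (simp add: ahograph_def)
  have "linked ?G u v \<longleftrightarrow> (adj S M)\<^sup>*\<^sup>* u v" if u: "u \<in> M" for u v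
  proof
    have *: "step_in ?G M = adj S M" by (intro ext) (auto simp: step_in_def edge adj_def)
    show "(adj S M)\<^sup>*\<^sup>* u v" if "linked ?G u v"
    proof -
      obtain p where p: "path ?G u p v" using \<open>linked ?G u v\<close> by (auto simp: linked_def)
      then have "set p \<subseteq> M" by (simp add: path_def verts)
      from walk_of_path[OF p this] show ?thesis by (simp add: *)
    qed
    show "linked ?G u v" if "(adj S M)\<^sup>*\<^sup>* u v"
      using path_of_walk[of ?G M u v] that u by (auto simp: * verts linked_def)
  qed
  then show ?thesis unfolding components_def verts component_def image_def by auto
qed

section \<open>Disconnectedness of Ahographs\<close>

definition separating :: "'a set set \<Rightarrow> 'a triple set \<Rightarrow> bool" where
  "separating H S \<longleftrightarrow> laminar H \<and> (\<forall>x y z. trip x y z \<in> S \<longrightarrow> separates H x y z)"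

lemma separatingD: "separating H S \<Longrightarrow> trip x y z \<in> S \<Longrightarrow> separates H x y z"
  by (simp add: separating_def)

lemma consistent_separating:
  assumes "consistent S"
  obtains H where "separating H S"
  using assms rooted_tree_laminar unfolding consistent_def separating_def by (metis subsetD)

text \<open>A maximal proper trace of a cluster on \<open>M\<close> is a union of components.\<close>

lemma ahograph_disconnected:
  assumes H: "separating H S" and M: "finite M" "x0 \<in> M" "M \<noteq> {x0}"
  shows "\<exists>x\<in>M. component S M x \<noteq> M"
proof (cases "\<exists>x y. adj S M x y")
  case False
  then have "y = x0" if "y \<in> component S M x0" for y
    using component_if_closed[OF that, of "{x0}"] by auto
  then show ?thesis using M by (metis component_refl singleton_iff subsetI subset_antisym insert_subset empty_subsetI)
next
  case True
  let ?F = "{C \<inter> M | C. C \<in> H} - {{}, M}"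
  \<comment> \<open>The cluster separating the triple behind an edge contains both ends and misses
    the third leaf, which lies in \<open>M\<close>; its trace is thus nonempty and proper.\<close>
  have tr: "\<exists>C\<in>H. x \<in> C \<and> y \<in> C \<and> C \<inter> M \<in> ?F" if xy: "adj S M x y" for x y
  proof -
    obtain z where z: "z \<in> M" "trip x y z \<in> S" using xy by (auto simp: adj_def)
    then obtain C where "C \<in> H" "x \<in> C" "y \<in> C" "z \<notin> C"
      using separatingD[OF H z(2)] unfolding separates_def by blast
    then show ?thesis using z xy by (intro bexI[of _ C]) (auto simp: adj_def)
  qed
  have "finite ?F" using M by (intro finite_subset[of ?F "Pow M"]) auto
  moreover have "?F \<noteq> {}" using tr True by (metis empty_iff)
  ultimately have "\<exists>N\<in>?F. \<forall>N'\<in>?F. N \<subseteq> N' \<longrightarrow> N = N'" by (rule finite_has_maximal)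
  then obtain N where N: "N \<in> ?F" and max: "\<forall>N'\<in>?F. N \<subseteq> N' \<longrightarrow> N = N'"
    by (rule bexE)
  from N obtain C where C: "N = C \<inter> M" "C \<in> H" "N \<noteq> {}" "N \<noteq> M" by auto
  from C(3) obtain x where x: "x \<in> N" by auto
  have closed: "v \<in> N" if u: "u \<in> N" and a: "adj S M u v" for u v
  proof -
    obtain D where D: "D \<in> H" "u \<in> D" "v \<in> D" "D \<inter> M \<in> ?F" using tr[OF a] by blast
    have v: "v \<in> M" using a by (simp add: adj_def)
    \<comment> \<open>\<open>C\<close> and \<open>D\<close> share \<open>u\<close>, so they are
      nested; if \<open>D\<close> is the larger one, maximality of \<open>N\<close> forces their
      traces to agree.\<close>
    have "C \<subseteq> D \<or> D \<subseteq> C" using H C D u by (auto simp: separating_def dest: laminarD)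
    then show ?thesis
    proof
      assume "C \<subseteq> D"
      then have "N \<subseteq> D \<inter> M" using C by blast
      then have "N = D \<inter> M" using bspec[OF max D(4)] by simp
      then show ?thesis using D v by simp
    next
      assume "D \<subseteq> C"
      then show ?thesis using D C v by auto
    qed
  qed
  have "component S M x \<subseteq> N" using component_if_closed[of _ S M x N] x closed by blast
  then show ?thesis using C x by (intro bexI[of _ x]) auto
qed

section \<open>Candidate splits and their union\<close>

text \<open>A pair \<open>{A, B}\<close> is represented by its union \<open>M\<close>, from which
  the components of \<open>a\<close> and \<open>c\<close> recover it. The conditions only ask for
  connections, which makes them stable under unions; distinctness of the components comes from
  \<open>bipartition_comps_ne\<close>.\<close>

definition bipartition :: "'a triple set \<Rightarrow> 'a \<Rightarrow> 'a \<Rightarrow> 'a \<Rightarrow> 'a set \<Rightarrow> bool" where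
  "bipartition S a b c M \<longleftrightarrow> M \<subseteq> leaf_set S \<and> c \<in> M \<and> b \<in> component S M a \<and>
     M \<subseteq> component S M a \<union> component S M c"

lemma bipartitionD:
  assumes "bipartition S a b c M"
  shows "M \<subseteq> leaf_set S" "a \<in> M" "b \<in> M" "c \<in> M" "b \<in> component S M a" "component S M a \<union> component S M c = M"
  using assms component_memD[of b S M a] component_subset[of S M] unfolding bipartition_def by auto

text \<open>If \<open>c\<close> were connected to \<open>a\<close>, all of \<open>M\<close> would be
  one component, against \<open>ahograph_disconnected\<close>.\<close>

lemma bipartition_comps_ne:
  assumes S: "separating H S" "finite (leaf_set S)" and "a \<noteq> c" and p: "bipartition S a b c M"
  shows "c \<notin> component S M a"
proof
  note d = bipartitionD[OF p]
  assume c: "c \<in> component S M a"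
  then have "component S M a = M" using d(6) component_eq by fastforce
  then have "component S M x = M" if "x \<in> M" for x using that component_eq by metis
  moreover have "M \<noteq> {a}" "finite M" using d \<open>a \<noteq> c\<close> S(2) finite_subset by auto
  ultimately show False using ahograph_disconnected[OF S(1) _ d(2), of] by blast
qed

lemma split_pairs_eq:
  assumes S: "separating H S" "finite (leaf_set S)" and ac: "a \<noteq> c"
  shows "split_pairs (trip a b c) S = (\<lambda>M. {component S M a, component S M c}) ` {M. bipartition S a b c M}"
proof (intro set_eqI iffI)
  fix q assume "q \<in> split_pairs (trip a b c) S"
  then obtain A B where q: "q = {A, B}" and AB: "A \<subseteq> leaf_set S" "B \<subseteq> leaf_set S"
    "component S (A \<union> B) ` (A \<union> B) = {A, B}" "a \<in> A" "b \<in> A" "c \<in> B"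
    by (auto simp: split_pairs_def components_ahograph trip_def)
  have *: "component S (A \<union> B) x = X" if "x \<in> X" "X \<in> {A, B}" for x X
    using that AB(3) component_eq[of x S "A \<union> B"] by (metis imageE)
  have "component S (A \<union> B) a = A" "component S (A \<union> B) c = B" using * AB by auto
  then show "q \<in> (\<lambda>M. {component S M a, component S M c}) ` {M. bipartition S a b c M}"
    using AB q by (intro image_eqI[of _ _ "A \<union> B"]) (auto simp: bipartition_def)
next
  fix q assume "q \<in> (\<lambda>M. {component S M a, component S M c}) ` {M. bipartition S a b c M}"
  then obtain M where q: "q = {component S M a, component S M c}" and M: "bipartition S a b c M" by blast
  note d = bipartitionD[OF M]
  have "component S M ` M = {component S M a, component S M c}"
  proof
    show "component S M ` M \<subseteq> {component S M a, component S M c}"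
    proof (rule image_subsetI)
      fix x assume "x \<in> M"
      then have "x \<in> component S M a \<or> x \<in> component S M c" using d(6) by blast
      then show "component S M x \<in> {component S M a, component S M c}" using component_eq by fast
    qed
  qed (use d in auto)
  moreover have "component S M a \<noteq> component S M c"
    using bipartition_comps_ne[OF S ac M] component_refl[OF d(4)] by blast
  ultimately show "q \<in> split_pairs (trip a b c) S"
    unfolding split_pairs_def components_ahograph trip_def fst_conv snd_conv mem_Collect_eq
    using q d subset_trans[OF component_subset d(1), of S] component_refl[OF d(2), of S] component_refl[OF d(4), of S]
    by - (rule exI[of _ "component S M a"], rule exI[of _ "component S M c"], simp)
qed

definition top_split :: "'a triple set \<Rightarrow> 'a \<Rightarrow> 'a \<Rightarrow> 'a \<Rightarrow> 'a set" where
  "top_split S a b c = \<Union>{M. bipartition S a b c M}"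

text \<open>Connections persist when the vertex set grows, so every vertex of the union is still
  connected to \<open>a\<close> or to \<open>c\<close>.\<close>

lemma top_split_bipartition:
  assumes M: "bipartition S a b c M"
  shows "bipartition S a b c (top_split S a b c)"
proof -
  let ?W = "top_split S a b c"
  have sub: "M' \<subseteq> ?W" if "bipartition S a b c M'" for M' using that by (auto simp: top_split_def)
  have mono: "component S M' x \<subseteq> component S ?W x" if "bipartition S a b c M'" for M' x
    using component_mono[OF order_refl sub[OF that]] .
  have "x \<in> component S ?W a \<union> component S ?W c" if x: "x \<in> ?W" for x
  proof -
    obtain M' where M': "bipartition S a b c M'" "x \<in> M'" using x by (auto simp: top_split_def)
    then show ?thesis using mono[OF M'(1)] bipartitionD(6)[OF M'(1)] by blast
  qed
  moreover have "?W \<subseteq> leaf_set S" by (auto simp: top_split_def dest: bipartitionD)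
  moreover have "b \<in> component S ?W a" "c \<in> ?W" using mono[OF M] sub[OF M] bipartitionD[OF M] by auto
  ultimately show ?thesis by (auto simp: bipartition_def)
qed

text \<open>Every candidate lies inside the finite set \<open>top_split S a b c\<close>, so one of
  maximal cardinality must equal it. This yields both existence and uniqueness for the definite
  description.\<close>

lemma max_split_eq:
  assumes S: "separating H S" "finite (leaf_set S)" and ac: "a \<noteq> c" and M: "bipartition S a b c M"
  shows "max_split (trip a b c) S =
    {component S (top_split S a b c) a, component S (top_split S a b c) c}"
proof -
  let ?W = "top_split S a b c"
  let ?f = "\<lambda>M. {component S M a, component S M c}"
  have W: "bipartition S a b c ?W" using top_split_bipartition[OF M] .
  have un: "\<Union>(?f M') = M'" if "bipartition S a b c M'" for M' using bipartitionD(6)[OF that] by auto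
  have fin: "finite ?W" using bipartitionD(1)[OF W] S(2) finite_subset by blast
  have sub: "M' \<subseteq> ?W" if "bipartition S a b c M'" for M' using that by (auto simp: top_split_def)
  have "is_arg_max (\<lambda>q. card (\<Union>q)) (\<lambda>q. q \<in> split_pairs (trip a b c) S) p \<longleftrightarrow> p = ?f ?W" for p
  proof
    assume "is_arg_max (\<lambda>q. card (\<Union>q)) (\<lambda>q. q \<in> split_pairs (trip a b c) S) p"
    then obtain M' where M': "bipartition S a b c M'" "p = ?f M'" "\<not> card (\<Union>p) < card (\<Union>(?f ?W))"
      using W unfolding is_arg_max_def split_pairs_eq[OF S ac] by blast
    then have "card ?W \<le> card M'" using un[OF W] un[OF M'(1)] by simp
    then have "M' = ?W" using card_seteq[OF fin sub[OF M'(1)]] by simp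
    then show "p = ?f ?W" using M' by simp
  next
    assume "p = ?f ?W"
    moreover have "\<not> card (\<Union>(?f ?W)) < card (\<Union>(?f M'))" if "bipartition S a b c M'" for M'
      using un[OF W] un[OF that] card_mono[OF fin sub[OF that]] by simp
    ultimately show "is_arg_max (\<lambda>q. card (\<Union>q)) (\<lambda>q. q \<in> split_pairs (trip a b c) S) p"
      using W unfolding is_arg_max_def split_pairs_eq[OF S ac] by blast
  qed
  then show ?thesis by (simp add: max_split_def)
qed

lemma triple_in_leaf_set: "trip x y z \<in> S \<Longrightarrow> {x, y, z} \<subseteq> leaf_set S"
  unfolding leaf_set_def trip_def by (auto intro!: bexI[of _ "({x, y}, z)"])

lemma separating_subset: "separating H S \<Longrightarrow> S' \<subseteq> S \<Longrightarrow> separating H S'"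
  by (auto simp: separating_def)

lemma laminar_traces: "laminar H \<Longrightarrow> laminar ((\<lambda>C. C \<inter> M) ` H)"
  unfolding laminar_def by blast

section \<open>Assembling hierarchies from components\<close>

definition separating_on :: "'a set set \<Rightarrow> 'a triple set \<Rightarrow> 'a set \<Rightarrow> bool" where
  "separating_on H S M \<longleftrightarrow> H \<subseteq> Pow M \<and> laminar H \<and>
     (\<forall>x y z. trip x y z \<in> S \<longrightarrow> {x, y, z} \<subseteq> M \<longrightarrow> separates H x y z)"

text \<open>\<open>N\<close> is a union of components of the Ahograph on \<open>M\<close>, so a
  hierarchy on \<open>N\<close> can be enlarged without touching it. The second conclusion records
  that every further cluster, apart from \<open>N\<close>, lies in a discarded component.\<close>

lemma separating_on_extend:
  assumes H0: "separating H0 S" and N: "N \<subseteq> M" "\<And>x. x \<in> N \<Longrightarrow> component S M x \<subseteq> N"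
    and H: "separating_on H S N"
  obtains H' where "separating_on H' S M"
    "\<forall>C\<in>H'. C \<in> insert N H \<or> (\<exists>x\<in>M - N. C \<subseteq> component S M x)"
proof
  \<comment> \<open>Each component outside \<open>N\<close> carries the traces of \<open>H0\<close>;
    \<open>UNIV\<close> contributes the component itself.\<close>
  define K where "K = {component S M x \<inter> C | x C. x \<in> M - N \<and> C \<in> insert UNIV H0}"
  let ?H = "insert N H \<union> K"
  show "\<forall>C\<in>?H. C \<in> insert N H \<or> (\<exists>x\<in>M - N. C \<subseteq> component S M x)"
    unfolding K_def by blast
  have out: "component S M x \<inter> N = {}" if x: "x \<in> M - N" for x
  proof -
    have "y \<notin> N" if "y \<in> component S M x" for y
      using N(2)[of y] component_commute[OF that] x by blast
    then show ?thesis by blast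
  qed
  have lam0: "laminar (insert UNIV H0)" using H0 by (auto simp: separating_def laminar_def)
  have nest: "C \<subseteq> D \<or> D \<subseteq> C \<or> C \<inter> D = {}" if CK: "C \<in> K" and DK: "D \<in> K" for C D
  proof -
    obtain x C' where C: "C = component S M x \<inter> C'" "C' \<in> insert UNIV H0" using CK unfolding K_def by blast
    obtain y D' where D: "D = component S M y \<inter> D'" "D' \<in> insert UNIV H0" using DK unfolding K_def by blast
    show ?thesis unfolding C(1) D(1)
      using component_disjoint[of S M x y] laminarD[OF lam0 C(2) D(2)] by blast
  qed
  have KN: "C \<inter> N = {}" if "C \<in> K" for C using that out unfolding K_def by blast
  have HN: "C \<subseteq> N" if "C \<in> insert N H" for C using that H by (auto simp: separating_on_def)
  have lamH: "laminar (insert N H)" using H by (auto simp: separating_on_def laminar_def)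
  have "laminar ?H"
    unfolding laminar_def
  proof (intro ballI)
    fix C D assume CD: "C \<in> ?H" "D \<in> ?H"
    then consider "C \<in> insert N H" "D \<in> insert N H" | "C \<in> K" "D \<in> K"
      | "C \<in> insert N H" "D \<in> K" | "C \<in> K" "D \<in> insert N H" by blast
    then show "C \<subseteq> D \<or> D \<subseteq> C \<or> C \<inter> D = {}"
    proof cases
      case 1 then show ?thesis by (rule laminarD[OF lamH])
    next
      case 2 then show ?thesis by (rule nest)
    next
      case 3 then show ?thesis using HN[of C] KN[of D] by blast
    next
      case 4 then show ?thesis using HN[of D] KN[of C] by blast
    qed
  qed
  moreover have "?H \<subseteq> Pow M" using HN N(1) component_subset[of S M] unfolding K_def by blast
  moreover have "separates ?H x y z" if t: "trip x y z \<in> S" "{x, y, z} \<subseteq> M" for x y z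
  \<comment> \<open>A triple whose pair lies in \<open>N\<close> is separated by \<open>H\<close>
    or, if its third leaf is outside, by \<open>N\<close> itself. For any other triple a trace of
    \<open>H0\<close> on the component of \<open>x\<close> works.\<close>
  proof (cases "x \<in> N")
    case True
    have "y \<in> component S M x"
    \<comment> \<open>\<open>S\<close> is an arbitrary set of pairs here, so \<open>x = y\<close>
      can occur, while \<open>adj\<close> relates distinct points only.\<close>
    proof (cases "x = y")
      case False
      then show ?thesis using t by (intro adj_component) (auto simp: adj_def)
    qed (use t component_refl in auto)
    then have y: "y \<in> N" using N(2) True by blast
    show ?thesis
    proof (cases "z \<in> N")
      case True
      then have "separates H x y z" using H t y \<open>x \<in> N\<close> by (simp add: separating_on_def)
      then show ?thesis unfolding separates_def by blast
    next
      case False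
      then show ?thesis using y True unfolding separates_def by blast
    qed
  next
    case False
    obtain C where C: "C \<in> H0" "x \<in> C" "y \<in> C" "z \<notin> C"
      using separatingD[OF H0 t(1)] unfolding separates_def by blast
    have "y \<in> component S M x"
    proof (cases "x = y")
      case False
      then show ?thesis using t by (intro adj_component) (auto simp: adj_def)
    qed (use t component_refl in auto)
    moreover have "x \<in> component S M x" using t component_refl by auto
    moreover have "component S M x \<inter> C \<in> K" using False t C unfolding K_def by blast
    ultimately show ?thesis unfolding separates_def
      using C by (intro bexI[of _ "component S M x \<inter> C"]) auto
  qed
  ultimately show "separating_on ?H S M" unfolding separating_on_def by blast
qed

text \<open>Induction along the shrinking of \<open>M\<close> to the components of \<open>a\<close>
  and \<open>c\<close>. A stable \<open>M\<close> is a bipartition; if \<open>b\<close> becomes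
  disconnected from \<open>a\<close>, the discarded pieces are put back one stage at a time without
  ever separating \<open>a\<close> and \<open>b\<close> from \<open>c\<close>.\<close>

lemma bipartition_or_separating:
  assumes H0: "separating H0 S" and M: "finite M" "M \<subseteq> leaf_set S" "a \<in> M" "b \<in> M" "c \<in> M"
  shows "(\<exists>M'. bipartition S a b c M') \<or> (\<exists>H. separating_on H S M \<and> \<not> separates H a b c)"
  using M
proof (induction M rule: finite_psubset_induct)
  case (psubset M)
  show ?case
  proof (cases "b \<in> component S M a")
    case False
    \<comment> \<open>Extending from the empty set confines every nonempty cluster to one component,
      and no component contains both \<open>a\<close> and \<open>b\<close>.\<close>
    have e: "separating_on {} S {}" by (auto simp: separating_on_def laminar_def)
    have c0: "component S M x \<subseteq> {}" if "x \<in> {}" for x using that by simp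
    obtain H where H: "separating_on H S M"
      "\<forall>C\<in>H. C \<in> insert {} {} \<or> (\<exists>x\<in>M - {}. C \<subseteq> component S M x)"
      using separating_on_extend[OF H0 empty_subsetI c0 e] .
    have "\<not> separates H a b c"
    proof
      assume "separates H a b c"
      then obtain C where C: "C \<in> H" "a \<in> C" "b \<in> C" unfolding separates_def by blast
      obtain x where "C \<subseteq> component S M x" using bspec[OF H(2) C(1)] C(2) by blast
      then have "a \<in> component S M x" "b \<in> component S M x" using C by auto
      then show False using False component_eq[of a S M x] by simp
    qed
    then show ?thesis using H(1) by blast
  next
    case True
    let ?N = "component S M a \<union> component S M c"
    have sub: "?N \<subseteq> M" using component_subset[of S M] by blast
    have mem: "a \<in> ?N" "b \<in> ?N" "c \<in> ?N" using True psubset.prems component_refl[of _ M S] by auto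
    show ?thesis
    proof (cases "?N = M")
      case True
      then have "bipartition S a b c M"
        using psubset.prems \<open>b \<in> component S M a\<close> by (simp add: bipartition_def)
      then show ?thesis by blast
    next
      case False
      then have "?N \<subset> M" "?N \<subseteq> leaf_set S" using sub psubset.prems by auto
      from psubset.IH[OF this mem] show ?thesis
      proof
        assume "\<exists>H. separating_on H S ?N \<and> \<not> separates H a b c"
        then obtain H where H: "separating_on H S ?N" "\<not> separates H a b c" by blast
        have cl: "component S M x \<subseteq> ?N" if "x \<in> ?N" for x
          using that component_eq by fast
        obtain H' where H': "separating_on H' S M"
          "\<forall>C\<in>H'. C \<in> insert ?N H \<or> (\<exists>x\<in>M - ?N. C \<subseteq> component S M x)"
          using separating_on_extend[OF H0 sub cl H(1)] .
        have "\<not> separates H' a b c"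
        proof
          assume "separates H' a b c"
          then obtain C where C: "C \<in> H'" "a \<in> C" "b \<in> C" "c \<notin> C" unfolding separates_def by blast
          \<comment> \<open>\<open>?N\<close> contains \<open>c\<close>, and \<open>H\<close> does
            not separate the triple, so \<open>C\<close> would lie in a discarded component, which
            cannot contain \<open>a\<close>.\<close>
          have "C \<notin> insert ?N H" using H(2) C mem unfolding separates_def by blast
          then obtain x where "x \<in> M - ?N" "a \<in> component S M x" using bspec[OF H'(2) C(1)] C(2) by blast
          then show False using component_commute by fast
        qed
        then show ?thesis using H'(1) by blast
      qed blast
    qed
  qed
qed

section \<open>Triples of the closure\<close>

context
  fixes R :: "'a triple set"
  assumes ts: "triple_set R" and con: "consistent R" and nonempty: "R \<noteq> {}"
begin

lemma triple_set_distinct: "trip x y z \<in> R \<Longrightarrow> distinct [x, y, z]"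
  using ts by (force simp: triple_set_def trip_eq_iff)

text \<open>Consistency forces finiteness: all labels are leaves of one finite tree.\<close>

lemma finite_leaf_set: "finite (leaf_set R)"
proof -
  obtain T where T: "rooted_tree T" "R \<subseteq> displayed_triples T" using con by (auto simp: consistent_def)
  have "Inl x \<in> leaves T" if x: "x \<in> leaf_set R" for x
  proof -
    obtain P c where P: "(P, c) \<in> R" "x \<in> insert c P" using x by (auto simp: leaf_set_def)
    then obtain a b c' where t: "(P, c) = trip a b c'" using ts unfolding triple_set_def by blast
    then have "displays T (Inl a) (Inl b) (Inl c')" using P T(2) trip_in_displayed_triples by fastforce
    then show ?thesis using P t by (auto simp: displays_def trip_def)
  qed
  then have "Inl ` leaf_set R \<subseteq> verts T" by (auto simp: leaves_def)
  moreover have "finite (verts T)" using T by (auto simp: rooted_tree_def tree_def simple_graph_def)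
  ultimately show ?thesis using finite_subset finite_imageD inj_Inl by (metis inj_on_subset subset_UNIV)
qed

lemma separating_on_tree:
  assumes H: "separating_on H R (leaf_set R)"
  obtains T where "rooted_tree T" "leaves T = Inl ` leaf_set R" "R \<subseteq> displayed_triples T"
    "\<forall>x y z. trip x y z \<in> displayed_triples T \<longrightarrow>
      distinct [x, y, z] \<and> {x, y, z} \<subseteq> leaf_set R \<and> separates H x y z"
proof -
  have form: "\<exists>x y z. t = trip x y z" if "t \<in> R" for t using that ts unfolding triple_set_def by blast
  \<comment> \<open>Nonemptiness of \<open>R\<close> supplies the two distinct leaves that
    \<open>hierarchy_tree\<close> asks for.\<close>
  obtain x y z where xyz: "trip x y z \<in> R" using nonempty form by (metis ex_in_conv)
  have x: "x \<in> leaf_set R" "leaf_set R \<noteq> {x}"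
    using triple_in_leaf_set[OF xyz] triple_set_distinct[OF xyz] by auto
  have H': "H \<subseteq> Pow (leaf_set R)" "laminar H" using H by (simp_all add: separating_on_def)
  obtain T :: "('a + nat) rooted_graph" where T: "rooted_tree T" "leaves T = Inl ` leaf_set R"
    "\<forall>x y z. trip x y z \<in> displayed_triples T \<longleftrightarrow>
       distinct [x, y, z] \<and> {x, y, z} \<subseteq> leaf_set R \<and> separates H x y z"
    using hierarchy_tree[OF finite_leaf_set x H'] .
  have "R \<subseteq> displayed_triples T"
  proof
    fix t assume t: "t \<in> R"
    then obtain x y z where e: "t = trip x y z" using form by blast
    have "trip x y z \<in> R" using t e by simp
    from triple_in_leaf_set[OF this] triple_set_distinct[OF this] this
    show "t \<in> displayed_triples T" unfolding e using H T(3) by (simp add: separating_on_def)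
  qed
  then show thesis using that[OF T(1,2)] T(3) by blast
qed

lemma subset_cl: "R \<subseteq> cl R"
  by (auto simp: cl_def)

text \<open>The closure lies inside the triples of a single tree with leaf set exactly that of
  \<open>R\<close>, and inherits its hierarchy and its leaf bound.\<close>

lemma cl_properties:
  obtains H where "separating H (cl R)"
    "\<forall>t\<in>cl R. \<exists>x y z. t = trip x y z \<and> distinct [x, y, z]"
    "leaf_set (cl R) = leaf_set R"
proof -
  obtain H0 where H0: "separating H0 R" using consistent_separating[OF con] .
  \<comment> \<open>The tree witnessing consistency may have additional leaves; taking traces
    removes them.\<close>
  let ?H = "(\<lambda>C. C \<inter> leaf_set R) ` H0"
  have "separates ?H x y z" if t: "trip x y z \<in> R" for x y z
  proof -
    obtain C where "C \<in> H0" "x \<in> C" "y \<in> C" "z \<notin> C"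
      using separatingD[OF H0 t] unfolding separates_def by blast
    then show ?thesis
      using triple_in_leaf_set[OF t] unfolding separates_def
      by (intro bexI[of _ "C \<inter> leaf_set R"]) auto
  qed
  moreover have "?H \<subseteq> Pow (leaf_set R)" by blast
  moreover have "laminar ?H" using H0 laminar_traces[of H0 "leaf_set R"] by (simp add: separating_def)
  ultimately have "separating_on ?H R (leaf_set R)" unfolding separating_on_def by blast
  from separating_on_tree[OF this]
  obtain T where T: "rooted_tree T" "leaves T = Inl ` leaf_set R" "R \<subseteq> displayed_triples T"
    "\<forall>x y z. trip x y z \<in> displayed_triples T \<longrightarrow>
      distinct [x, y, z] \<and> {x, y, z} \<subseteq> leaf_set R \<and> separates ?H x y z" .
  \<comment> \<open>With \<open>T\<close> in the intersected family, the intersection is not the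
    whole type.\<close>
  have clT: "cl R \<subseteq> displayed_triples T" unfolding cl_def using T(1-3) by blast
  have form: "\<exists>x y z. t = trip x y z \<and> distinct [x, y, z] \<and> {x, y, z} \<subseteq> leaf_set R" if "t \<in> cl R" for t
  proof -
    have t: "t \<in> displayed_triples T" using that clT by blast
    then obtain x y z where e: "t = trip x y z" by (auto simp: displayed_triples_def)
    then show ?thesis using T(4) t by metis
  qed
  obtain H where "separating H (displayed_triples T)"
    using rooted_tree_laminar[OF T(1)] unfolding separating_def by metis
  then have H: "separating H (cl R)" using clT separating_subset by blast
  have "leaf_set R \<subseteq> leaf_set (cl R)" unfolding leaf_set_def using subset_cl by (rule UN_mono) simp
  moreover have "leaf_set (cl R) \<subseteq> leaf_set R"
  proof
    fix v assume "v \<in> leaf_set (cl R)"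
    then obtain P c where P: "(P, c) \<in> cl R" "v \<in> insert c P" by (auto simp: leaf_set_def)
    obtain x y z where "(P, c) = trip x y z" "{x, y, z} \<subseteq> leaf_set R" using form[OF P(1)] by blast
    then show "v \<in> leaf_set R" using P(2) by (auto simp: trip_def)
  qed
  ultimately have "leaf_set (cl R) = leaf_set R" by blast
  then show thesis using that[OF H] form by blast
qed

text \<open>Otherwise \<open>bipartition_or_separating\<close> supplies a hierarchy, hence a tree on
  the same leaves, that displays \<open>R\<close> but not this triple.\<close>

lemma cl_bipartition:
  assumes t: "trip a b c \<in> cl R"
  shows "bipartition R a b c (top_split R a b c)"
proof -
  obtain H0 where H0: "separating H0 R" using consistent_separating[OF con] .
  have "leaf_set (cl R) = leaf_set R" using cl_properties by metis
  then have mem: "a \<in> leaf_set R" "b \<in> leaf_set R" "c \<in> leaf_set R" using triple_in_leaf_set[OF t] by auto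
  from bipartition_or_separating[OF H0 finite_leaf_set order_refl mem]
  have "\<exists>M. bipartition R a b c M"
  proof
    assume "\<exists>H. separating_on H R (leaf_set R) \<and> \<not> separates H a b c"
    then obtain H where H: "separating_on H R (leaf_set R)" "\<not> separates H a b c" by blast
    obtain T where
      T: "rooted_tree T" "leaves T = Inl ` leaf_set R" "R \<subseteq> displayed_triples T"
      and disp: "\<forall>x y z. trip x y z \<in> displayed_triples T \<longrightarrow>
        distinct [x, y, z] \<and> {x, y, z} \<subseteq> leaf_set R \<and> separates H x y z"
      using separating_on_tree[OF H(1)] .
    have "trip a b c \<notin> displayed_triples T" using H(2) disp by blast
    with T have "trip a b c \<notin> cl R" unfolding cl_def by blast
    then show ?thesis using t by blast
  qed
  then show ?thesis by (elim exE) (rule top_split_bipartition)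
qed

text \<open>Adding to \<open>M\<close> the splits of all triples responsible for its edges turns every edge of the
  Ahograph of the closure into a connection in the Ahograph of \<open>R\<close>, and attaches all new vertices.\<close>

lemma cl_bipartition_extend:
  assumes M: "bipartition (cl R) a b c M"
  shows "\<exists>U. M \<subseteq> U \<and> bipartition R a b c U"
proof -
  have L: "leaf_set (cl R) = leaf_set R" using cl_properties by metis
  let ?Q = "\<lambda>x y z. {x, y, z} \<subseteq> M \<and> trip x y z \<in> cl R"
  define U where "U = M \<union> \<Union>{top_split R x y z | x y z. ?Q x y z}"
  have MU: "M \<subseteq> U" and topU: "\<And>x y z. ?Q x y z \<Longrightarrow> top_split R x y z \<subseteq> U"
    unfolding U_def by blast+
  have sub: "component R (top_split R x y z) v \<subseteq> component R U v" if "?Q x y z" for x y z v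
    using component_mono[OF order_refl topU[OF that]] .
  note d = bipartitionD[OF M]
  \<comment> \<open>An edge \<open>uv\<close> due to a closure triple becomes a connection inside
    the split of that triple.\<close>
  have comp: "component (cl R) M x \<subseteq> component R U x" for x
  proof (rule component_subset_if_adj[OF _ MU])
    fix u v assume "adj (cl R) M u v"
    then obtain z where Q: "?Q u v z" by (auto simp: adj_def)
    then have "v \<in> component R (top_split R u v z) u"
      by (intro bipartitionD(5)[OF cl_bipartition]) simp
    then show "v \<in> component R U u" using sub[OF Q] by blast
  qed
  have inM: "x \<in> component R U a \<or> x \<in> component R U c" if "x \<in> M" for x
    using that comp[of a] comp[of c] d(6) by blast
  have "x \<in> component R U a \<or> x \<in> component R U c" if x: "x \<in> U" for x
  proof (cases "x \<in> M")
    case False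
    then obtain u v z where Q: "?Q u v z" and xt: "x \<in> top_split R u v z"
      using x unfolding U_def by blast
    have B: "bipartition R u v z (top_split R u v z)" using Q by (intro cl_bipartition) simp
    \<comment> \<open>A vertex added by the split of a triple is connected to \<open>u\<close> or
      \<open>z\<close>, which are old vertices.\<close>
    have "x \<in> component R U u \<union> component R U z"
      using bipartitionD(6)[OF B] xt sub[OF Q] by blast
    then obtain w where w: "w \<in> M" "x \<in> component R U w" using Q by blast
    from inM[OF w(1)] show ?thesis
      using component_trans[OF _ w(2)] by (elim disjE) simp_all
  qed (rule inM)
  moreover have "x \<in> leaf_set R" if x: "x \<in> U" for x
  proof (cases "x \<in> M")
    case False
    then obtain u v z where Q: "?Q u v z" and xt: "x \<in> top_split R u v z"
      using x unfolding U_def by blast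
    then have "bipartition R u v z (top_split R u v z)" by (intro cl_bipartition) simp
    then show ?thesis using bipartitionD(1) xt by fast
  qed (use d(1) L in auto)
  moreover have "b \<in> component R U a" using comp d(5) by blast
  ultimately have "bipartition R a b c U" using d(4) MU unfolding bipartition_def by blast
  then show ?thesis using MU by blast
qed

text \<open>More triples only add edges, and the leaf set does not change.\<close>

lemma bipartition_cl: "bipartition R a b c M \<Longrightarrow> bipartition (cl R) a b c M"
proof -
  assume M: "bipartition R a b c M"
  have L: "leaf_set (cl R) = leaf_set R" using cl_properties by metis
  have *: "component R M x \<subseteq> component (cl R) M x" for x
    using component_mono[OF subset_cl order_refl] .
  show ?thesis
    using bipartitionD[OF M] *[of a] *[of c] L unfolding bipartition_def by auto
qed

lemma max_split_cl:
  assumes t: "t \<in> cl R"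
  shows "max_split t (cl R) = max_split t R"
proof -
  obtain H where H: "separating H (cl R)" and L: "leaf_set (cl R) = leaf_set R"
    and form: "\<forall>t\<in>cl R. \<exists>x y z. t = trip x y z \<and> distinct [x, y, z]"
    using cl_properties by metis
  obtain a b c where abc: "t = trip a b c" "distinct [a, b, c]" using form t by blast
  have HR: "separating H R" using separating_subset[OF H subset_cl] .
  have fin: "finite (leaf_set (cl R))" using L finite_leaf_set by simp
  have ac: "a \<noteq> c" using abc by simp
  let ?W = "top_split R a b c"
  have B: "bipartition R a b c ?W" using cl_bipartition t abc by blast
  have C: "bipartition (cl R) a b c ?W" using bipartition_cl[OF B] .
  have W: "top_split (cl R) a b c = ?W"
  proof
    show "top_split (cl R) a b c \<subseteq> ?W"
      unfolding top_split_def using cl_bipartition_extend by blast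
    show "?W \<subseteq> top_split (cl R) a b c"
      unfolding top_split_def using bipartition_cl by blast
  qed
  \<comment> \<open>Both pairs of components cover \<open>?W\<close>, and those for \<open>R\<close>
    lie inside those for \<open>cl R\<close>; as the latter are disjoint, the pairs agree.\<close>
  have "component (cl R) ?W a \<inter> component (cl R) ?W c = {}"
  proof -
    have "c \<notin> component (cl R) ?W a" by (rule bipartition_comps_ne[OF H fin ac C])
    moreover have "c \<in> component (cl R) ?W c" using component_refl bipartitionD(4)[OF C] .
    ultimately show ?thesis using component_disjoint[of "cl R" ?W a c] by blast
  qed
  moreover have "component R ?W x \<subseteq> component (cl R) ?W x" for x
    using component_mono[OF subset_cl order_refl] .
  ultimately have "component R ?W a = component (cl R) ?W a" "component R ?W c = component (cl R) ?W c"
    using bipartitionD(6)[OF B] bipartitionD(6)[OF C] by blast+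
  then show ?thesis
    unfolding abc(1) max_split_eq[OF H fin ac C] max_split_eq[OF HR finite_leaf_set ac B] W by simp
qed

lemma max_split_attained:
  assumes t: "t \<in> cl R"
  shows "\<exists>s\<in>R. max_split s R = max_split t R"
proof -
  obtain H where H: "separating H R" using consistent_separating[OF con] .
  obtain a b c where abc: "t = trip a b c" "distinct [a, b, c]" using cl_properties t by metis
  then have ac: "a \<noteq> c" by simp
  let ?W = "top_split R a b c"
  let ?A = "component R ?W a"
  have B: "bipartition R a b c ?W" using cl_bipartition t abc by blast
  note d = bipartitionD[OF B]
  \<comment> \<open>If no triple had its pair in \<open>?A\<close> and its third leaf on the other
    side, every edge within \<open>?A\<close> would come from a triple inside \<open>?A\<close>.
    Then the Ahograph on \<open>?A\<close> would be connected, although \<open>?A\<close> contains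
    the distinct points \<open>a\<close> and \<open>b\<close>.\<close>
  have "\<exists>x y z. x \<in> ?A \<and> y \<in> ?A \<and> z \<in> component R ?W c \<and> trip x y z \<in> R"
  proof (rule ccontr)
    assume no: "\<not> ?thesis"
    have adjA: "adj R ?A u v" if u: "u \<in> ?A" and uv: "adj R ?W u v" for u v
    proof -
      have v: "v \<in> ?A" using u adj_component[OF uv] component_trans by fast
      obtain z where z: "z \<in> ?W" "trip u v z \<in> R" "u \<noteq> v" using uv by (auto simp: adj_def)
      then have "z \<in> ?A" using no u v d(6) by blast
      then show ?thesis using z u v by (auto simp: adj_def)
    qed
    have aA: "a \<in> ?A" using d(2) by (rule component_refl)
    have "?A \<subseteq> component R ?A a"
    proof
      fix y assume y: "y \<in> ?A"
      have "v \<in> component R ?A a" if u: "u \<in> component R ?A a" and uv: "adj R ?W u v" for u v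
      proof -
        have "adj R ?A u v" using adjA uv component_memD[OF u] by blast
        then show ?thesis using u component_trans adj_component by fast
      qed
      then show "y \<in> component R ?A a"
        using component_if_closed[OF y, of "component R ?A a"] component_refl[OF aA, of R] by blast
    qed
    then have "component R ?A a = ?A" using component_subset[of R ?A a] by (rule subset_antisym[rotated])
    then have "\<forall>x\<in>?A. component R ?A x = ?A" using component_eq by metis
    moreover have "finite ?A"
      using component_subset[of R ?W a] d(1) finite_leaf_set finite_subset by metis
    moreover have "?A \<noteq> {a}" using d(5) abc by auto
    ultimately show False using ahograph_disconnected[OF H _ aA] by blast
  qed
  then obtain x y z where xyz: "x \<in> ?A" "y \<in> ?A" "z \<in> component R ?W c" "trip x y z \<in> R" by blast
  have xz: "x \<noteq> z" using triple_set_distinct[OF xyz(4)] by simp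
  have eqs: "component R ?W x = ?A" "component R ?W z = component R ?W c"
    by (rule component_eq[OF xyz(1)], rule component_eq[OF xyz(3)])
  \<comment> \<open>The new triple has the same two components on \<open>?W\<close>, so
    \<open>?W\<close> is a candidate for it as well and lies in its top split
    \<open>?V\<close>.\<close>
  have B': "bipartition R x y z ?W"
    unfolding bipartition_def eqs using d xyz component_memD[OF xyz(3)] by simp
  let ?V = "top_split R x y z"
  have V: "bipartition R x y z ?V" by (rule top_split_bipartition[OF B'])
  have WV: "?W \<subseteq> ?V" using B' unfolding top_split_def by blast
  have mono: "component R ?W v \<subseteq> component R ?V v" for v
    by (rule component_mono[OF order_refl WV])
  have eqV: "component R ?V x = component R ?V a" "component R ?V z = component R ?V c"
    by (rule component_eq[OF subsetD[OF mono xyz(1)]], rule component_eq[OF subsetD[OF mono xyz(3)]])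
  have "b \<in> component R ?V a" using mono d(5) by (rule subsetD)
  \<comment> \<open>Conversely, on \<open>?V\<close> the points \<open>x\<close> and
    \<open>a\<close> are still connected, as are \<open>z\<close> and \<open>c\<close>, so
    \<open>?V\<close> is a candidate for the original triple and the two top splits agree.\<close>
  then have "bipartition R a b c ?V"
    using bipartitionD(1,6)[OF V] subsetD[OF WV d(4)] unfolding bipartition_def eqV by simp
  then have "?V = ?W" using WV unfolding top_split_def by blast
  then have "max_split (trip x y z) R = max_split t R"
    unfolding abc(1) max_split_eq[OF H finite_leaf_set ac B]
      max_split_eq[OF H finite_leaf_set xz B'] using eqs by simp
  then show ?thesis using xyz(4) by blast
qed

end

text \<open>The single-vertex tree has no leaves and displays nothing, so it empties the
  intersection. This settles the case excluded by \<open>nonempty\<close>.\<close>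

lemma cl_empty: "cl ({} :: 'a triple set) = {}"
proof -
  define T :: "('a + nat) rooted_graph" where "T = \<lparr> verts = {Inr 0}, edges = {}, root = Inr 0 \<rparr>"
  have "linked T (Inr 0) (Inr 0)"
    unfolding linked_def by (rule exI[of _ "[Inr 0]"]) (simp add: path_def T_def)
  moreover have "\<not> cycle T p" for p
    by (auto simp: cycle_def T_def)
  moreover have lv: "leaves T = {}" by (auto simp: leaves_def degree_def T_def)
  ultimately have "rooted_tree T"
    by (auto simp: rooted_tree_def tree_def simple_graph_def inner_verts_def lv) (auto simp: T_def)
  moreover have "displayed_triples T = {}"
    using lv by (auto simp: displayed_triples_def displays_def)
  ultimately show ?thesis using lv unfolding cl_def by (auto simp: leaf_set_def)
qed

theorem mainTheorem8:
  fixes R :: "'a triple set"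
  assumes "triple_set R" and "consistent R"
  shows "max_splits R R = max_splits (cl R) R \<and>
         max_splits (cl R) R = max_splits (cl R) (cl R)"
proof (cases "R = {}")
  case True
  then show ?thesis by (simp add: cl_empty)
next
  case False
  note R = assms False
  have img: "max_splits S' S = (\<lambda>r. max_split r S) ` S'" for S' S :: "'a triple set"
    unfolding max_splits_def by blast
  have "max_splits (cl R) R \<subseteq> max_splits R R"
    unfolding img
  proof (rule image_subsetI)
    fix t assume "t \<in> cl R"
    then obtain s where "s \<in> R" "max_split s R = max_split t R"
      using max_split_attained[OF R] by blast
    then show "max_split t R \<in> (\<lambda>r. max_split r R) ` R" by (metis imageI)
  qed
  moreover have "max_splits R R \<subseteq> max_splits (cl R) R"
    unfolding img by (rule image_mono[OF subset_cl[OF R]])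
  moreover have "max_splits (cl R) R = max_splits (cl R) (cl R)"
    unfolding img by (rule image_cong[OF refl max_split_cl[OF R, symmetric]])
  ultimately show ?thesis by simp
qed

end
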